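(* Let $f=(f_1,\dots,f_m):\mathscr{D}(f)\subseteq\mathbb{R}^n\to\mathbb{R}^m$ be a nonlinear function, let $C=\bigcap_{i=1}^{k_c}C_i$ be a nonempty intersection of finitely many nonempty closed convex sets $C_i\subseteq\mathbb{R}^n$, and let $x_0\in\mathscr{D}(f)$. Assume that (i) $f$ satisfies the local tangential cone condition in the ball $\mathscr{B}_\rho(x_0)$; (ii) for every $x\in\mathscr{D}(f)$ the Jacobian $f'(x)$ is row bounded below and is a full column rank matrix; and that the problem "$f(x)=0$ subject to $x\in C$" is solvable in $\mathscr{B}_{\rho/2}(x_0)$. Then the iteration sequence $\{x_k\}_{k=0}^\infty$ generated by the APSKM method (started at $x_0$) converges in expectation to a solution $x^*\in\mathscr{B}_{\rho/2}(x_0)$ of this problem. Moreover, the mean squared iteration error satisfies, for $k=1,2,\dots$, $$E\|x_k-x^*\|^2\le\left(1-\frac{(1-2\eta)\,\sigma_{\min}^2(f'(x_{k-1}))}{m(1+\eta)^2\|f'(x_{k-1})\|_F^2}\right)E\|x_{k-1}-x^*\|^2,$$ where $\eta=\max_i\eta_i<\frac12$ $(i=1,\dots,m)$ is the constant of the local tangential cone condition.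
   Context: $f$ is differentiable, with Jacobian $f'(x)\in\mathbb{R}^{m\times n}$ whose $i$th row is the gradient $\nabla f_i(x)$ (a row vector). $\|\cdot\|$ is the Euclidean norm, $\|\cdot\|_\infty$ the max norm, $\|\cdot\|_F$ the Frobenius norm, $\sigma_{\min}(A)$ the smallest nonzero singular value of $A$. $\mathscr{B}_r(x_0)=\{x:\|x-x_0\|\le r\}$. $P_X$ is the metric projection onto a closed convex set $X$. Row bounded below: a matrix $A\in\mathbb{R}^{m\times n}$ is row bounded below if there is $\varepsilon>0$ with $\|A(i,:)\|\ge\varepsilon$ for all $1\le i\le m$, where $A(i,:)$ is the $i$th row. Local tangential cone condition: $f$ satisfies it in the ball $\mathscr{B}_\rho(x_0)\subset\mathscr{D}(f)$ of radius $\rho$ around $x_0$ if for every $i\in\{1,\dots,m\}$ and all $x_1,x_2\in\mathscr{B}_\rho(x_0)$ there exists $\eta_i\in[0,\eta]$, where $\eta=\max_i\eta_i<\frac12$, such that $|f_i(x_1)-f_i(x_2)-\nabla f_i(x_1)(x_1-x_2)|\le\eta_i|f_i(x_1)-f_i(x_2)|$. APSKM method (accelerated projected sampling Kaczmarz-Motzkin): fix a sample size $\beta\in\{1,\dots,m\}$, a tolerance $\delta>0$ and the initial point $x_0$. For $k=1,2,\dots$: choose a subset $\tau_k\subseteq\{1,\dots,m\}$ of size $\beta$ uniformly at random; let $i_k\in\arg\max_{i\in\tau_k}|f_i(x_{k-1})|$; set $x_{k-\frac45}=x_{k-1}-\frac{f_{i_k}(x_{k-1})}{\|\nabla f_{i_k}(x_{k-1})\|^2}\nabla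 f_{i_k}(x_{k-1})^T$; choose two indices $\alpha_1^k,\alpha_2^k$ uniformly at random from $\{1,\dots,k_c\}$; set $x_{k-\frac35}=P_{C_{\alpha_1^k}}(x_{k-\frac45})$ and $x_{k-\frac25}=P_{C_{\alpha_2^k}}(x_{k-\frac35})$. If $\|x_{k-\frac25}-x_{k-\frac35}\|_\infty<\delta$, set $x_k=x_{k-\frac25}$. Otherwise set $x_{k-\frac15}=P_{C_{\alpha_1^k}}(x_{k-\frac25})$, $\lambda_k=\frac{\|x_{k-\frac35}-x_{k-\frac25}\|^2}{\langle x_{k-\frac35}-x_{k-\frac15},\,x_{k-\frac35}-x_{k-\frac25}\rangle}$ and $x_k=x_{k-\frac35}+\lambda_k(x_{k-\frac15}-x_{k-\frac35})$. $E$ denotes expectation over the random choices of the method; convergence of $x_k$ to $x^*$ in expectation refers to $E\|x_k-x^*\|^2\to0$.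
   Formalization: The displayed factor depends on the random iterate x_{k-1}, so outside the expectation the bound is ill-defined or false; it is proved conditionally on the past and, in total expectation, with the factor inside the expectation on the right. *)

theory Defs
  imports "HOL-Probability.Probability"
begin

(* Square roots of the eigenvalues of A^T A.  For m < n this lists extra zeros compared with the
   convention of min(m,n) singular values; the nonzero ones agree. *)
definition singular_value :: "real^'n^'m \<Rightarrow> real \<Rightarrow> bool" where
  "singular_value A s \<longleftrightarrow> s \<ge> 0 \<and> (\<exists>v. v \<noteq> 0 \<and> (transpose A ** A) *v v = s\<^sup>2 *\<^sub>R v)"

definition sigma_min :: "real^'n^'m \<Rightarrow> real" where
  "sigma_min A = Min {s. singular_value A s \<and> s \<noteq> 0}"

lemma singular_value_eq_norm:
  assumes "(transpose A ** A) *v v = s\<^sup>2 *\<^sub>R v" and "norm v = 1" and "s \<ge> 0"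
  shows "s = norm (A *v (v :: real^'n))"
proof -
  have "(norm (A *v v))\<^sup>2 = (A *v v) \<bullet> (A *v v)"
    by (simp add: power2_norm_eq_inner)
  also have "\<dots> = v \<bullet> ((transpose A ** A) *v v)"
    by (metis dot_lmul_matrix inner_commute matrix_vector_mul_assoc transpose_matrix_vector)
  also have "\<dots> = s\<^sup>2"
    using assms(1,2) by (simp add: dot_square_norm)
  finally show ?thesis
    using assms(3) by (simp add: power2_eq_iff_nonneg)
qed

(* Makes the Min in sigma_min meaningful: eigenvectors of A^T A for distinct eigenvalues
   are orthogonal. *)
lemma finite_singular_values: "finite {s. singular_value (A :: real^'n^'m) s}"
proof -
  let ?B = "transpose A ** A"
  define w where "w s = (SOME v. v \<noteq> 0 \<and> ?B *v v = s\<^sup>2 *\<^sub>R v)" for s :: real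
  let ?S = "{s. singular_value A s}"
  have w: "w s \<noteq> 0" "?B *v w s = s\<^sup>2 *\<^sub>R w s" if "s \<in> ?S" for s
    using that someI_ex[of "\<lambda>v. v \<noteq> 0 \<and> ?B *v v = s\<^sup>2 *\<^sub>R v"]
    unfolding w_def singular_value_def by auto
  have symm: "u \<bullet> (?B *v v) = (?B *v u) \<bullet> v" for u v
    by (metis dot_lmul_matrix matrix_transpose_mul transpose_matrix_vector transpose_transpose)
  have orth: "w s \<bullet> w t = 0" if "s \<in> ?S" "t \<in> ?S" "s \<noteq> t" for s t
  proof -
    have "t\<^sup>2 * (w s \<bullet> w t) = s\<^sup>2 * (w s \<bullet> w t)"
      using symm[of "w s" "w t"] w[OF that(1)] w[OF that(2)] by simp
    moreover have "s\<^sup>2 \<noteq> t\<^sup>2"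
      using that by (auto simp: singular_value_def power2_eq_iff_nonneg)
    ultimately show ?thesis by auto
  qed
  have inj: "inj_on w ?S"
    by (rule inj_onI) (metis orth w(1) inner_eq_zero_iff)
  have "pairwise orthogonal (w ` ?S)"
    unfolding pairwise_def orthogonal_def using orth by auto
  moreover have "0 \<notin> w ` ?S"
    using w(1) by auto
  ultimately have "independent (w ` ?S)"
    by (rule pairwise_orthogonal_independent)
  then have "finite (w ` ?S)"
    using independent_bound by blast
  then show ?thesis
    using inj by (rule finite_imageD)
qed

definition frobenius_norm :: "real^'n^'m \<Rightarrow> real" where
  "frobenius_norm A = sqrt (\<Sum>i\<in>UNIV. \<Sum>j\<in>UNIV. (A $ i $ j)\<^sup>2)"

lemma frobenius_norm_eq_norm: "frobenius_norm A = norm A"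
  by (simp add: frobenius_norm_def norm_vec_def L2_set_def sum_nonneg)

definition row_bounded_below :: "real^'n^'m \<Rightarrow> bool" where
  "row_bounded_below A \<longleftrightarrow> (\<exists>\<epsilon>>0. \<forall>i. norm (row i A) \<ge> \<epsilon>)"

(* J x is the Jacobian of f at x, so row i (J x) is the gradient of the i-th component.
   eta is a common bound below 1/2 for the constants eta_i, e.g. their maximum. *)
definition local_tangential_cone ::
    "(real^'n \<Rightarrow> real^'m) \<Rightarrow> (real^'n \<Rightarrow> real^'n^'m) \<Rightarrow> (real^'n) set \<Rightarrow> real^'n \<Rightarrow> real \<Rightarrow> real \<Rightarrow> bool" where
  "local_tangential_cone f J D x0 \<rho> \<eta> \<longleftrightarrow>
     cball x0 \<rho> \<subseteq> D \<and> \<eta> < 1/2 \<and>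
     (\<forall>i. \<forall>x1\<in>cball x0 \<rho>. \<forall>x2\<in>cball x0 \<rho>. \<exists>\<eta>i\<in>{0..\<eta>}.
        \<bar>f x1 $ i - f x2 $ i - row i (J x1) \<bullet> (x1 - x2)\<bar> \<le> \<eta>i * \<bar>f x1 $ i - f x2 $ i\<bar>)"

(* One step from x with chosen row i and set indices a1, a2;
   y1, y2, y3, y4 are the iterates with fractional indices k-4/5, k-3/5, k-2/5, k-1/5. *)
definition apskm_step ::
    "(real^'n \<Rightarrow> real^'m) \<Rightarrow> (real^'n \<Rightarrow> real^'n^'m) \<Rightarrow> (nat \<Rightarrow> (real^'n) set) \<Rightarrow> real
     \<Rightarrow> real^'n \<Rightarrow> 'm \<Rightarrow> nat \<Rightarrow> nat \<Rightarrow> real^'n" where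
  "apskm_step f J C \<delta> x i a1 a2 =
    (let y1 = x - (f x $ i / (norm (row i (J x)))\<^sup>2) *\<^sub>R row i (J x);
         y2 = closest_point (C a1) y1;
         y3 = closest_point (C a2) y2
     in if infnorm (y3 - y2) < \<delta> then y3
        else let y4 = closest_point (C a1) y3;
                 lam = (norm (y2 - y3))\<^sup>2 / ((y2 - y4) \<bullet> (y2 - y3))
             in y2 + lam *\<^sub>R (y4 - y2))"

(* A run of the method on a probability space M.  F k contains all information up to round k, and
   the random choices of round k + 1 are independent of it.  The tie-breaking in the arg max may
   be random and depend on the past, but not on later choices.  The two set indices are drawn
   independently of each other and of the sample, i.e. the triple of choices is uniform. *)
locale apskm = prob_space M + filtration "space M" F
  for M :: "'w measure" and F :: "nat \<Rightarrow> 'w measure" +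
  fixes f :: "real^'n \<Rightarrow> real^'m" and J :: "real^'n \<Rightarrow> real^'n^'m"
    and C :: "nat \<Rightarrow> (real^'n) set" and kc :: nat
    and \<beta> :: nat and \<delta> :: real and x0 :: "real^'n"
    and \<tau> :: "nat \<Rightarrow> 'w \<Rightarrow> 'm set" and \<alpha>1 \<alpha>2 :: "nat \<Rightarrow> 'w \<Rightarrow> nat"
    and i :: "nat \<Rightarrow> 'w \<Rightarrow> 'm" and x :: "nat \<Rightarrow> 'w \<Rightarrow> real^'n"
  assumes subalgebra_F: "\<And>k. subalgebra M (F k)"
    and sample_size: "\<beta> \<in> {1..CARD('m)}"
    and tolerance: "\<delta> > 0"
    and choices_adapted:
      "\<And>k. (\<lambda>\<omega>. (\<tau> (Suc k) \<omega>, \<alpha>1 (Suc k) \<omega>, \<alpha>2 (Suc k) \<omega>)) \<in> F (Suc k) \<rightarrow>\<^sub>M count_space UNIV"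
    and choices_uniform:
      "\<And>k. distr M (count_space UNIV) (\<lambda>\<omega>. (\<tau> (Suc k) \<omega>, \<alpha>1 (Suc k) \<omega>, \<alpha>2 (Suc k) \<omega>)) =
           measure_pmf (pmf_of_set ({S. card S = \<beta>} \<times> {1..kc} \<times> {1..kc}))"
    and choices_indep:
      "\<And>k. indep_set (sets (F k))
           {(\<lambda>\<omega>. (\<tau> (Suc k) \<omega>, \<alpha>1 (Suc k) \<omega>, \<alpha>2 (Suc k) \<omega>)) -` B \<inter> space M | B. B \<in> UNIV}"
    and row_adapted: "\<And>k. i (Suc k) \<in> F (Suc k) \<rightarrow>\<^sub>M count_space UNIV"
    and row_max:
      "\<And>k \<omega>. \<omega> \<in> space M \<Longrightarrow>
         is_arg_max (\<lambda>j. \<bar>f (x k \<omega>) $ j\<bar>) (\<lambda>j. j \<in> \<tau> (Suc k) \<omega>) (i (Suc k) \<omega>)"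
    and start: "\<And>\<omega>. \<omega> \<in> space M \<Longrightarrow> x 0 \<omega> = x0"
    and iterate:
      "\<And>k \<omega>. \<omega> \<in> space M \<Longrightarrow>
         x (Suc k) \<omega> = apskm_step f J C \<delta> (x k \<omega>) (i (Suc k) \<omega>) (\<alpha>1 (Suc k) \<omega>) (\<alpha>2 (Suc k) \<omega>)"

end

theory Submission
  imports Defs
begin

text \<open>
  Fix a solution \<open>z\<close> in the ball of radius \<open>\<rho>/2\<close>. One round of the method never increases the
  distance to \<open>z\<close>. The Kaczmarz step for the row \<open>j\<close> decreases its square by at least
  \<open>(1 - 2\<eta>) f\<^sub>j(x)\<^sup>2 / \<parallel>\<nabla>f\<^sub>j(x)\<parallel>\<^sup>2\<close>, because the tangential cone condition forces
  \<open>f\<^sub>j(x)\<close> and \<open>\<nabla>f\<^sub>j(x) (x - z)\<close> to have the same sign and comparable size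
  (\<open>kaczmarz_step_decrease\<close>). The two projections are nonexpansive and fix \<open>z\<close>. The extrapolation
  is harmless as well, although its step length \<open>\<lambda>\<^sub>k\<close> can be large: it only goes as far as the
  hyperplane that supports the second set at the projection (\<open>accelerated_projection_le\<close>).
  So the iterates stay within \<open>\<rho>/2\<close> of \<open>z\<close>, where all hypotheses apply.

  The sample contains a given row with probability \<open>\<beta>/m\<close>, independently of the past, and
  the largest squared residual over a sample is at least the average over the sample. Hence the
  conditional expectation of the squared residual of the chosen row is at least
  \<open>\<parallel>f(x)\<parallel>\<^sup>2 / m\<close> (\<open>expected_decrease\<close>). By the tangential cone condition,
  \<open>(1 + \<eta>) \<parallel>f(x)\<parallel> \<ge> \<parallel>f'(x) (x - z)\<parallel> \<ge> \<sigma>\<^sub>m\<^sub>i\<^sub>n(f'(x)) \<parallel>x - z\<parallel>\<close>, which gives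
  the stated error bound.

  The contraction factor in that bound depends on the iterate, and \<open>f'\<close> is not assumed continuous,
  so convergence needs a uniform factor. Two more consequences of the tangential cone
  condition provide it. With the roles of \<open>x\<close> and \<open>z\<close> exchanged it gives
  \<open>(1 + \<eta>) \<parallel>f(x)\<parallel> \<ge> \<sigma>\<^sub>m\<^sub>i\<^sub>n(f'(z)) \<parallel>x - z\<parallel>\<close> with a constant independent of
  \<open>x\<close>. Applied to the points of the ball it bounds \<open>f'\<close> there by the oscillation of \<open>f\<close>
  (\<open>tangential_cone_jacobian_bounded\<close>).

  Measurability comes from the discreteness of the choices: the iterates take only countably many
  values, since each round has countably many outcomes (\<open>iterate_adapted\<close>).
\<close>

section \<open>The smallest singular value\<close>

text \<open>
  A minimiser of the norm of \<open>A v\<close> on the unit sphere is a right singular vector: minimality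
  says that the quadratic form \<open>\<parallel>A v\<parallel>\<^sup>2 - s\<^sup>2 \<parallel>v\<parallel>\<^sup>2\<close> is nonnegative and vanishes at the minimiser,
  so its gradient \<open>2 w\<close> vanishes there too.
\<close>
lemma least_singular_value:
  fixes A :: "real^'n^'m"
  obtains s where "singular_value A s" and "\<And>v. s * norm v \<le> norm (A *v v)"
proof -
  have "\<exists>u\<in>sphere (0::real^'n) 1. \<forall>v\<in>sphere 0 1. norm (A *v u) \<le> norm (A *v v)"
    by (intro continuous_attains_inf continuous_on_norm linear_continuous_on
          matrix_vector_mul_bounded_linear) auto
  then obtain u where u: "norm u = 1"
    and u_min: "\<And>v. norm v = 1 \<Longrightarrow> norm (A *v u) \<le> norm (A *v v)"
    by auto
  define s where "s = norm (A *v u)"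
  have bound: "s * norm v \<le> norm (A *v v)" for v
  proof (cases "v = 0")
    case False
    have "s \<le> norm (A *v (v /\<^sub>R norm v))"
      unfolding s_def by (rule u_min) (use False in simp)
    also have "\<dots> = norm (A *v v) / norm v"
      by (simp add: matrix_vector_mult_scaleR divide_inverse_commute)
    finally show ?thesis
      using False by (simp add: field_simps)
  qed simp
  define w where "w = (transpose A ** A) *v u - s\<^sup>2 *\<^sub>R u"
  define q where "q = (norm (A *v w))\<^sup>2 - s\<^sup>2 * (norm w)\<^sup>2"
  have Auw: "(A *v u) \<bullet> (A *v w) = ((transpose A ** A) *v u) \<bullet> w"
    by (metis dot_lmul_matrix matrix_vector_mul_assoc transpose_matrix_vector)
  have quad: "0 \<le> 2 * t * (norm w)\<^sup>2 + t\<^sup>2 * q" for t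
  proof -
    have "(s * norm (u + t *\<^sub>R w))\<^sup>2 \<le> (norm (A *v (u + t *\<^sub>R w)))\<^sup>2"
      by (intro power_mono bound) (simp add: s_def)
    moreover have "(norm (A *v (u + t *\<^sub>R w)))\<^sup>2
        = s\<^sup>2 + 2 * t * ((A *v u) \<bullet> (A *v w)) + t\<^sup>2 * (norm (A *v w))\<^sup>2"
      unfolding s_def power2_norm_eq_inner
      by (simp add: matrix_vector_right_distrib matrix_vector_mult_scaleR inner_add_left
          inner_add_right inner_commute power2_eq_square algebra_simps)
    moreover have "(norm (u + t *\<^sub>R w))\<^sup>2 = 1 + 2 * t * (u \<bullet> w) + t\<^sup>2 * (norm w)\<^sup>2"
    proof -
      have "u \<bullet> u = 1" using u by (simp add: dot_square_norm)
      then show ?thesis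
        unfolding power2_norm_eq_inner
        by (simp add: inner_add_left inner_add_right inner_commute power2_eq_square algebra_simps)
    qed
    moreover have "(A *v u) \<bullet> (A *v w) = (norm w)\<^sup>2 + s\<^sup>2 * (u \<bullet> w)"
      unfolding Auw by (simp add: w_def power2_norm_eq_inner inner_diff_left)
    ultimately have "s\<^sup>2 * (1 + 2 * t * (u \<bullet> w) + t\<^sup>2 * (norm w)\<^sup>2)
        \<le> s\<^sup>2 + 2 * t * ((norm w)\<^sup>2 + s\<^sup>2 * (u \<bullet> w)) + t\<^sup>2 * (norm (A *v w))\<^sup>2"
      by (simp only: power_mult_distrib)
    then show ?thesis
      by (simp add: q_def algebra_simps)
  qed
  have "w = 0"
  proof (rule ccontr)
    assume "w \<noteq> 0"
    define a c where "a = (norm w)\<^sup>2" and "c = \<bar>q\<bar> + 1"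
    have ac: "a > 0" "c > 0" "q \<le> c"
      using \<open>w \<noteq> 0\<close> by (auto simp: a_def c_def)
    have "2 * (- a / c) * a + (- a / c)\<^sup>2 * q \<le> 2 * (- a / c) * a + (- a / c)\<^sup>2 * c"
      using ac by (intro add_left_mono mult_left_mono) auto
    also have "\<dots> = - (a\<^sup>2 / c)"
      using ac by (simp add: field_simps power2_eq_square)
    also have "\<dots> < 0"
      using ac by simp
    finally show False
      using quad[of "- a / c"] by (simp add: a_def)
  qed
  then have "singular_value A s"
    using u unfolding singular_value_def w_def s_def
    by (intro conjI exI[of _ u]) auto
  then show thesis
    using bound by (rule that)
qed

text \<open>
  For an injective matrix zero is not a singular value, so the smallest nonzero singular value
  is the smallest one and bounds the matrix from below on all vectors.
\<close>
lemma sigma_min_full_column_rank: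
  fixes A :: "real^'n^'m"
  assumes "rank A = CARD('n)"
  shows "0 < sigma_min A" and "\<And>v. sigma_min A * norm v \<le> norm (A *v v)"
proof -
  let ?S = "{s. singular_value A s \<and> s \<noteq> 0}"
  have inj: "A *v v = 0 \<longleftrightarrow> v = 0" for v
    using assms unfolding full_rank_injective
    by (metis injD matrix_vector_mult_0_right)
  obtain s where s: "singular_value A s" "\<And>v. s * norm v \<le> norm (A *v v)"
    using least_singular_value by blast
  have "s \<noteq> 0"
    using s(1) inj unfolding singular_value_def
    by (metis dot_lmul_matrix inner_eq_zero_iff matrix_vector_mul_assoc scaleR_zero_left
        transpose_matrix_vector vector_transpose_matrix zero_power2 inner_zero_left)
  then have "s \<in> ?S"
    using s(1) by simp
  have fin: "finite ?S"
    using finite_singular_values[of A] by (rule rev_finite_subset) auto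
  have "sigma_min A \<in> ?S"
    unfolding sigma_min_def using fin \<open>s \<in> ?S\<close> by (intro Min_in) auto
  then show "0 < sigma_min A"
    by (auto simp: singular_value_def)
  have "sigma_min A \<le> s"
    unfolding sigma_min_def using fin \<open>s \<in> ?S\<close> by (rule Min_le)
  then show "sigma_min A * norm v \<le> norm (A *v v)" for v
    using s(2)[of v] by (meson mult_right_mono norm_ge_zero order_trans)
qed

lemma norm_matrix_vector_le_frobenius:
  fixes A :: "real^'n^'m"
  shows "norm (A *v v) \<le> frobenius_norm A * norm v"
proof -
  have "norm (A *v v) \<le> norm (\<chi> j. norm (A $ j) * norm v)"
    by (rule norm_le_componentwise_cart)
       (simp add: matrix_vector_mul_component Cauchy_Schwarz_ineq2)
  also have "\<dots> = norm A * norm v"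
    by (simp add: norm_vec_def L2_set_left_distrib)
  finally show ?thesis
    by (simp add: frobenius_norm_eq_norm)
qed

lemma sigma_min_le_frobenius:
  fixes A :: "real^'n^'m"
  assumes "rank A = CARD('n)"
  shows "sigma_min A \<le> frobenius_norm A"
proof -
  obtain v :: "real^'n" where "norm v = 1"
    using vector_choose_size[of 1] by auto
  then show ?thesis
    using sigma_min_full_column_rank(2)[OF assms, of v] norm_matrix_vector_le_frobenius[of A v]
    by simp
qed

lemma norm_row_le_frobenius: "norm (row j A) \<le> frobenius_norm A"
  by (simp add: frobenius_norm_eq_norm row_def Finite_Cartesian_Product.norm_nth_le)

section \<open>Projections and the extrapolated step\<close>

lemma norm_closest_point_le:
  fixes S :: "'a::euclidean_space set"
  assumes "closed S" "convex S" "z \<in> S"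
  shows "norm (closest_point S y - z) \<le> norm (y - z)"
  using closest_point_lipschitz[OF assms(2,1), of y z] assms closest_point_self[of z S]
  by (auto simp: dist_norm)

text \<open>
  With \<open>d = y'' - y\<close> and \<open>u = y' - y\<close>, the extrapolation length is \<open>a / p\<close> for
  \<open>a = \<parallel>u\<parallel>\<^sup>2\<close> and \<open>p = \<langle>u, d\<rangle>\<close>. The point moves away from \<open>y\<close> along \<open>d\<close>, and it does
  not move away from \<open>z\<close> as long as the length times \<open>b = \<parallel>d\<parallel>\<^sup>2\<close> is at most twice \<open>\<langle>d, z - y\<rangle>\<close>.
  The variational inequalities of the two projections at \<open>z\<close> give
  \<open>\<langle>d, z - y\<rangle> \<ge> a - p + b\<close>, and the one at \<open>y\<close>, together with Cauchy-Schwarz, gives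
  \<open>b \<le> p \<le> a\<close>. What remains is an inequality between three real numbers. If \<open>p = 0\<close>, the
  length is the quotient by zero, that is zero, and the point does not move.
\<close>
lemma accelerated_projection_le:
  fixes S T :: "'a::euclidean_space set"
  assumes S: "closed S" "convex S" and T: "closed T" "convex T"
    and z: "z \<in> S" "z \<in> T" and y: "y \<in> S"
  defines "y' \<equiv> closest_point T y" and "y'' \<equiv> closest_point S (closest_point T y)"
  defines "l \<equiv> (norm (y - y'))\<^sup>2 / ((y - y'') \<bullet> (y - y'))"
  shows "norm (y + l *\<^sub>R (y'' - y) - z) \<le> norm (y - z)"
proof -
  define d u s where "d = y'' - y" and "u = y' - y" and "s = z - y"
  define a b p where "a = u \<bullet> u" and "b = d \<bullet> d" and "p = u \<bullet> d"
  have "(y' - y'') \<bullet> (y - y'') \<le> 0"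
    unfolding y''_def y'_def using S y by (intro closest_point_dot)
  then have "b \<le> p"
    by (simp add: a_def b_def p_def d_def u_def inner_diff_left inner_diff_right inner_commute)
  have "(y - y') \<bullet> (z - y') \<le> 0"
    unfolding y'_def using T z by (intro closest_point_dot)
  then have us: "a \<le> u \<bullet> s"
    by (simp add: a_def u_def s_def inner_diff_left inner_diff_right inner_commute)
  have "(y' - y'') \<bullet> (z - y'') \<le> 0"
    unfolding y''_def y'_def using S z by (intro closest_point_dot)
  then have ds: "u \<bullet> s - p + b \<le> d \<bullet> s"
    by (simp add: b_def p_def u_def d_def s_def inner_diff_left inner_diff_right inner_commute)
  have b0: "0 \<le> b" and a0: "0 \<le> a"
    by (simp_all add: a_def b_def)
  have l: "l = a / p"
    by (simp add: l_def a_def p_def u_def d_def power2_norm_eq_inner inner_diff_left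
        inner_diff_right inner_commute algebra_simps)
  have "l * (l * b) \<le> l * (2 * (d \<bullet> s))"
  proof (cases "p = 0")
    case False
    then have p: "p > 0"
      using \<open>b \<le> p\<close> b0 by simp
    have pp: "p\<^sup>2 \<le> a * b"
      unfolding a_def b_def p_def by (rule Cauchy_Schwarz_ineq)
    have "p \<le> a"
    proof (rule ccontr)
      assume "\<not> p \<le> a"
      then have "a * b < p * p"
        using \<open>b \<le> p\<close> p a0 b0 by (meson le_less_trans mult_left_mono mult_strict_right_mono not_le)
      with pp show False by (simp add: power2_eq_square)
    qed
    \<comment> \<open>both summands on the right are nonnegative because \<open>b \<le> p \<le> a\<close>\<close>
    have "2 * p * (a - p + b) - a * b = 2 * ((a - p) * (p - b)) + a * b"
      by (simp add: algebra_simps)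
    moreover have "0 \<le> (a - p) * (p - b)" "0 \<le> a * b"
      using \<open>p \<le> a\<close> \<open>b \<le> p\<close> a0 b0 by auto
    ultimately have "a * b \<le> 2 * p * (a - p + b)"
      by linarith
    then have "l * b \<le> 2 * (a - p + b)"
      using p by (simp add: l field_simps)
    also have "\<dots> \<le> 2 * (d \<bullet> s)"
      using us ds by simp
    finally show ?thesis
      using p a0 by (intro mult_left_mono) (auto simp: l)
  qed (simp add: l)
  moreover have "(norm (y + l *\<^sub>R (y'' - y) - z))\<^sup>2
      = (norm (y - z))\<^sup>2 + l * (l * b) - l * (2 * (d \<bullet> s))"
    unfolding power2_norm_eq_inner b_def d_def[symmetric] s_def
    by (simp add: inner_add_left inner_add_right inner_diff_left inner_diff_right inner_commute
        algebra_simps)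
  ultimately have "(norm (y + l *\<^sub>R (y'' - y) - z))\<^sup>2 \<le> (norm (y - z))\<^sup>2"
    by linarith
  then show ?thesis
    by (rule power2_le_imp_le) simp
qed


section \<open>The local tangential cone condition\<close>

text \<open>
  The constant of the condition may depend on the pair of points; replacing it by its upper bound
  gives a single inequality that can be applied to any two points of the ball.
\<close>
lemma local_tangential_coneD:
  assumes "local_tangential_cone f J D x0 \<rho> \<eta>" and "\<rho> \<ge> 0"
  shows "cball x0 \<rho> \<subseteq> D" and "\<eta> < 1/2" and "0 \<le> \<eta>"
    and "\<And>j x1 x2. x1 \<in> cball x0 \<rho> \<Longrightarrow> x2 \<in> cball x0 \<rho> \<Longrightarrow>
      \<bar>f x1 $ j - f x2 $ j - row j (J x1) \<bullet> (x1 - x2)\<bar> \<le> \<eta> * \<bar>f x1 $ j - f x2 $ j\<bar>"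
proof -
  note tcc = assms(1)[unfolded local_tangential_cone_def]
  show "cball x0 \<rho> \<subseteq> D" and "\<eta> < 1/2"
    using tcc by auto
  have "x0 \<in> cball x0 \<rho>"
    using assms(2) by simp
  with tcc obtain \<eta>i where "\<eta>i \<in> {0..\<eta>}"
    by blast
  then show "0 \<le> \<eta>"
    by simp
  fix j x1 x2
  assume "x1 \<in> cball x0 \<rho>" "x2 \<in> cball x0 \<rho>"
  with tcc obtain \<eta>i where "\<eta>i \<in> {0..\<eta>}"
    "\<bar>f x1 $ j - f x2 $ j - row j (J x1) \<bullet> (x1 - x2)\<bar> \<le> \<eta>i * \<bar>f x1 $ j - f x2 $ j\<bar>"
    by blast
  then show "\<bar>f x1 $ j - f x2 $ j - row j (J x1) \<bullet> (x1 - x2)\<bar> \<le> \<eta> * \<bar>f x1 $ j - f x2 $ j\<bar>"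
    by (meson abs_ge_zero atLeastAtMost_iff mult_right_mono order_trans)
qed

lemma tangential_cone_jacobian_le:
  assumes "local_tangential_cone f J D x0 \<rho> \<eta>" and "\<rho> \<ge> 0"
    and "x1 \<in> cball x0 \<rho>" and "x2 \<in> cball x0 \<rho>"
  shows "norm (J x1 *v (x1 - x2)) \<le> (1 + \<eta>) * norm (f x1 - f x2)"
proof -
  have "0 \<le> \<eta>"
    by (rule local_tangential_coneD(3)[OF assms(1,2)])
  have "norm (J x1 *v (x1 - x2)) \<le> norm ((1 + \<eta>) *\<^sub>R (f x1 - f x2))"
  proof (rule norm_le_componentwise_cart)
    fix j
    have "\<bar>row j (J x1) \<bullet> (x1 - x2)\<bar> \<le> \<bar>f x1 $ j - f x2 $ j\<bar> + \<eta> * \<bar>f x1 $ j - f x2 $ j\<bar>"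
      using local_tangential_coneD(4)[OF assms, of j] by linarith
    then show "norm ((J x1 *v (x1 - x2)) $ j) \<le> norm (((1 + \<eta>) *\<^sub>R (f x1 - f x2)) $ j)"
      using \<open>0 \<le> \<eta>\<close>
      by (simp add: matrix_vector_mul_component row_def abs_mult distrib_right
          del: matrix_vector_mult_diff_distrib)
  qed
  then show ?thesis
    using \<open>0 \<le> \<eta>\<close> by simp
qed

text \<open>
  The condition bounds \<open>f'(y) (y - y')\<close> by a multiple of the oscillation of \<open>f\<close>, for every \<open>y'\<close> in
  the ball. The centre of the ball may be displaced by \<open>\<rho>\<close> in any direction, and differences of the
  resulting vectors \<open>y - y'\<close> are multiples of that direction even when \<open>y\<close> lies on the boundary.
\<close>
lemma tangential_cone_jacobian_bounded:
  fixes f :: "real^'n \<Rightarrow> real^'m" and J :: "real^'n \<Rightarrow> real^'n^'m"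
  assumes tcc: "local_tangential_cone f J D x0 \<rho> \<eta>" and "\<rho> > 0"
    and cont: "continuous_on (cball x0 \<rho>) f"
  obtains B where "\<And>y. y \<in> cball x0 \<rho> \<Longrightarrow> frobenius_norm (J y) \<le> B"
proof -
  have \<rho>: "\<rho> \<ge> 0"
    using \<open>\<rho> > 0\<close> by simp
  have "bounded (f ` cball x0 \<rho>)"
    by (intro compact_imp_bounded compact_continuous_image cont compact_cball)
  then obtain K where K: "\<And>y. y \<in> cball x0 \<rho> \<Longrightarrow> norm (f y) \<le> K"
    unfolding bounded_iff by (meson image_eqI)
  define L where "L = (1 + \<eta>) * (2 * K)"
  have L: "norm (J y *v (y - y')) \<le> L" if "y \<in> cball x0 \<rho>" "y' \<in> cball x0 \<rho>" for y y'
  proof -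
    have "norm (J y *v (y - y')) \<le> (1 + \<eta>) * norm (f y - f y')"
      by (rule tangential_cone_jacobian_le[OF tcc \<rho> that])
    also have "norm (f y - f y') \<le> 2 * K"
      using norm_triangle_ineq4[of "f y" "f y'"] K[OF that(1)] K[OF that(2)] by simp
    finally show ?thesis
      using local_tangential_coneD(3)[OF tcc \<rho>] by (simp add: L_def mult_left_mono)
  qed
  have rows: "norm (row j (J y)) \<le> L / \<rho>" if y: "y \<in> cball x0 \<rho>" for j y
  proof -
    \<comment> \<open>the direction in which the component \<open>j\<close> of \<open>f'(y)\<close> is largest\<close>
    define e where "e = \<rho> *\<^sub>R sgn (row j (J y))"
    have "norm e \<le> \<rho>"
      using \<rho> by (simp add: e_def norm_sgn)
    then have e: "x0 - e \<in> cball x0 \<rho>" "x0 + e \<in> cball x0 \<rho>"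
      by (simp_all add: dist_norm)
    have "2 *\<^sub>R e = (y - (x0 - e)) - (y - (x0 + e))"
      by (simp add: algebra_simps scaleR_2)
    then have "norm (J y *v (2 *\<^sub>R e))
        \<le> norm (J y *v (y - (x0 - e))) + norm (J y *v (y - (x0 + e)))"
      by (metis matrix_vector_mult_diff_distrib norm_triangle_ineq4)
    also have "\<dots> \<le> L + L"
      by (intro add_mono L y e)
    finally have "norm (J y *v (2 *\<^sub>R e)) \<le> L + L" .
    moreover have "\<bar>(J y *v (2 *\<^sub>R e)) $ j\<bar> \<le> norm (J y *v (2 *\<^sub>R e))"
      by (rule component_le_norm_cart)
    moreover have "(J y *v (2 *\<^sub>R e)) $ j = 2 * \<rho> * norm (row j (J y))"
    proof -
      have "row j (J y) \<bullet> sgn (row j (J y)) = norm (row j (J y))"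
        by (cases "row j (J y) = 0")
           (simp_all add: sgn_div_norm dot_square_norm power2_eq_square)
      then show ?thesis
        by (simp add: matrix_vector_mul_component row_def e_def)
    qed
    ultimately have "\<rho> * norm (row j (J y)) \<le> L"
      by linarith
    then show ?thesis
      using \<open>\<rho> > 0\<close> by (simp add: field_simps)
  qed
  have "frobenius_norm (J y) \<le> (\<Sum>j\<in>(UNIV :: 'm set). L / \<rho>)" if y: "y \<in> cball x0 \<rho>" for y
  proof -
    have "frobenius_norm (J y) \<le> (\<Sum>j\<in>UNIV. norm (J y $ j))"
      by (simp add: frobenius_norm_eq_norm norm_vec_def L2_set_le_sum)
    also have "\<dots> \<le> (\<Sum>j\<in>(UNIV :: 'm set). L / \<rho>)"
      by (rule sum_mono) (use rows[OF y] in \<open>simp add: row_def\<close>)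
    finally show ?thesis .
  qed
  then show thesis
    by (rule that)
qed

section \<open>One round of the method\<close>

text \<open>
  The step changes the squared distance by
  \<open>(r\<^sup>2 - 2 r \<langle>g, x - z\<rangle>) / \<parallel>g\<parallel>\<^sup>2\<close>. The hypothesis says that \<open>\<langle>g, x - z\<rangle>\<close> deviates from \<open>r\<close> by at
  most \<open>\<eta> \<bar>r\<bar>\<close>, so \<open>r \<langle>g, x - z\<rangle>\<close> is at least \<open>(1 - \<eta>) r\<^sup>2\<close>.
\<close>
lemma kaczmarz_step_decrease:
  fixes x z g :: "'a::real_inner"
  assumes "g \<noteq> 0" and tcc: "\<bar>r - g \<bullet> (x - z)\<bar> \<le> \<eta> * \<bar>r\<bar>"
  shows "(norm (x - (r / (norm g)\<^sup>2) *\<^sub>R g - z))\<^sup>2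
    \<le> (norm (x - z))\<^sup>2 - (1 - 2 * \<eta>) * r\<^sup>2 / (norm g)\<^sup>2"
proof -
  let ?t = "r / (norm g)\<^sup>2"
  have g: "(norm g)\<^sup>2 > 0"
    using assms(1) by simp
  have expand: "(norm (d - t *\<^sub>R g))\<^sup>2 = (norm d)\<^sup>2 - 2 * t * (g \<bullet> d) + t\<^sup>2 * (norm g)\<^sup>2" for d t
    unfolding power2_norm_eq_inner
    by (simp add: inner_diff_left inner_diff_right inner_commute power2_eq_square algebra_simps)
  have "x - ?t *\<^sub>R g - z = (x - z) - ?t *\<^sub>R g"
    by simp
  then have "(norm (x - ?t *\<^sub>R g - z))\<^sup>2
      = (norm (x - z))\<^sup>2 - 2 * ?t * (g \<bullet> (x - z)) + ?t\<^sup>2 * (norm g)\<^sup>2"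
    by (simp only: expand)
  also have "?t\<^sup>2 * (norm g)\<^sup>2 = r\<^sup>2 / (norm g)\<^sup>2"
    using g by (simp add: power2_eq_square)
  also have "(norm (x - z))\<^sup>2 - 2 * ?t * (g \<bullet> (x - z)) + r\<^sup>2 / (norm g)\<^sup>2
      = (norm (x - z))\<^sup>2 - (2 * (r * (g \<bullet> (x - z))) - r\<^sup>2) / (norm g)\<^sup>2"
    by (simp add: diff_divide_distrib mult_ac del: inner_diff_right)
  also have "\<dots> \<le> (norm (x - z))\<^sup>2 - ((1 - 2 * \<eta>) * r\<^sup>2) / (norm g)\<^sup>2"
  proof -
    have "r * (r - g \<bullet> (x - z)) \<le> \<bar>r\<bar> * \<bar>r - g \<bullet> (x - z)\<bar>"
      by (metis abs_ge_self abs_mult)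
    also have "\<dots> \<le> \<bar>r\<bar> * (\<eta> * \<bar>r\<bar>)"
      using tcc by (rule mult_left_mono) simp
    also have "\<dots> = \<eta> * r\<^sup>2"
      by (simp add: power2_eq_square)
    finally have "(1 - 2 * \<eta>) * r\<^sup>2 \<le> 2 * (r * (g \<bullet> (x - z))) - r\<^sup>2"
      by (simp only: right_diff_distrib left_diff_distrib power2_eq_square)
    then show ?thesis
      by (intro diff_left_mono divide_right_mono) auto
  qed
  finally show ?thesis .
qed

lemma apskm_step_decrease:
  assumes sets: "\<And>a. a \<in> {a1, a2} \<Longrightarrow> closed (C a) \<and> convex (C a) \<and> z \<in> C a"
    and row: "row j (J x) \<noteq> 0"
    and tcc: "\<bar>f x $ j - row j (J x) \<bullet> (x - z)\<bar> \<le> \<eta> * \<bar>f x $ j\<bar>"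
  shows "(norm (apskm_step f J C \<delta> x j a1 a2 - z))\<^sup>2
    \<le> (norm (x - z))\<^sup>2 - (1 - 2 * \<eta>) * (f x $ j)\<^sup>2 / (norm (row j (J x)))\<^sup>2"
proof -
  have C1: "closed (C a1)" "convex (C a1)" "z \<in> C a1"
    and C2: "closed (C a2)" "convex (C a2)" "z \<in> C a2"
    using sets by auto
  define y1 where "y1 = x - (f x $ j / (norm (row j (J x)))\<^sup>2) *\<^sub>R row j (J x)"
  define y2 where "y2 = closest_point (C a1) y1"
  have "y2 \<in> C a1"
    unfolding y2_def using C1 by (intro closest_point_in_set) auto
  have "norm (apskm_step f J C \<delta> x j a1 a2 - z) \<le> norm (y2 - z)"
    using norm_closest_point_le[OF C2, of y2]
      accelerated_projection_le[OF C1(1,2) C2(1,2) C1(3) C2(3) \<open>y2 \<in> C a1\<close>]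
    by (simp add: apskm_step_def Let_def flip: y1_def y2_def)
  also have "\<dots> \<le> norm (y1 - z)"
    unfolding y2_def by (rule norm_closest_point_le[OF C1])
  finally have "(norm (apskm_step f J C \<delta> x j a1 a2 - z))\<^sup>2 \<le> (norm (y1 - z))\<^sup>2"
    by (intro power_mono) auto
  also have "\<dots> \<le> (norm (x - z))\<^sup>2 - (1 - 2 * \<eta>) * (f x $ j)\<^sup>2 / (norm (row j (J x)))\<^sup>2"
    unfolding y1_def by (rule kaczmarz_step_decrease[OF row tcc])
  finally show ?thesis .
qed

section \<open>The random choices\<close>

text \<open>
  Double counting of the pairs of a subset and one of its elements: by symmetry under
  transpositions every element lies in equally many subsets of a given size.
\<close>
lemma card_subsets_containing:
  fixes j :: "'m::finite"
  shows "\<beta> * card {S :: 'm set. card S = \<beta>} = CARD('m) * card {S. card S = \<beta> \<and> j \<in> S}"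
proof -
  let ?c = "\<lambda>j. card {S :: 'm set. card S = \<beta> \<and> j \<in> S}"
  have eq: "?c j' = ?c j" for j'
  proof -
    have "bij_betw ((`) (Transposition.transpose j j'))
        {S :: 'm set. card S = \<beta> \<and> j' \<in> S} {S. card S = \<beta> \<and> j \<in> S}"
      by (rule bij_betw_byWitness[where f' = "(`) (Transposition.transpose j j')"])
         (auto simp: image_image card_image intro: rev_image_eqI[of j' _ j] rev_image_eqI[of j _ j'])
    then show ?thesis
      by (rule bij_betw_same_card)
  qed
  have "\<beta> * card {S :: 'm set. card S = \<beta>} = (\<Sum>S | card (S :: 'm set) = \<beta>. card S)"
    by simp
  also have "\<dots> = (\<Sum>S | card S = \<beta>. \<Sum>j'\<in>(UNIV :: 'm set). of_bool (j' \<in> S))"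
    by (intro sum.cong refl) (simp add: of_bool_def sum.If_cases)
  also have "\<dots> = (\<Sum>j'\<in>(UNIV :: 'm set). \<Sum>S | card S = \<beta>. of_bool (j' \<in> S))"
    by (rule sum.swap)
  also have "\<dots> = (\<Sum>j'\<in>(UNIV :: 'm set). ?c j')"
    by (intro sum.cong refl) (simp add: of_bool_def sum.If_cases Int_def conj_commute)
  also have "\<dots> = (\<Sum>j'\<in>(UNIV :: 'm set). ?c j)"
    by (intro sum.cong refl eq)
  also have "\<dots> = CARD('m) * ?c j"
    by simp
  finally show ?thesis .
qed

text \<open>
  The independence of \<open>B\<close> from each event \<open>A\<close> of the subalgebra says exactly that the constant
  \<open>prob B\<close> has the same integral over \<open>A\<close> as the indicator of \<open>B\<close>.
\<close>
lemma (in prob_space) real_cond_exp_indep_event: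
  assumes sub: "subalgebra M G" and indep: "indep_set (sets G) \<B>" and B: "B \<in> \<B>"
  shows "AE \<omega> in M. real_cond_exp M G (indicator B) \<omega> = prob B"
proof -
  interpret finite_measure_subalgebra M G
    by unfold_locales (rule sub)
  have [measurable]: "B \<in> sets M"
    using indep B unfolding indep_set_def indep_sets_def UNIV_bool by auto
  show ?thesis
  proof (rule real_cond_exp_charact)
    fix A assume A: "A \<in> sets G"
    then have [measurable]: "A \<in> sets M"
      using sub unfolding subalgebra_def by blast
    have "(\<integral>\<omega>\<in>A. indicator B \<omega> \<partial>M) = prob (A \<inter> B)"
      by (simp add: set_lebesgue_integral_def flip: indicator_inter_arith)
    also have "\<dots> = (\<integral>\<omega>\<in>A. prob B \<partial>M)"
      using indep_setD[OF indep A B] by (simp add: set_lebesgue_integral_def)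
    finally show "(\<integral>\<omega>\<in>A. indicator B \<omega> \<partial>M) = (\<integral>\<omega>\<in>A. prob B \<partial>M)" .
  next
    show "integrable M (indicator B :: _ \<Rightarrow> real)"
      by (rule integrable_real_indicator) (simp_all add: less_top[symmetric])
  qed simp_all
qed

context apskm
begin

lemma choices_measurable:
  "(\<lambda>\<omega>. (\<tau> (Suc k) \<omega>, \<alpha>1 (Suc k) \<omega>, \<alpha>2 (Suc k) \<omega>)) \<in> M \<rightarrow>\<^sub>M count_space UNIV"
  using choices_adapted subalgebra_F by (rule measurable_from_subalg[rotated])

lemma sampled_nonempty: "{S :: 'm set. card S = \<beta>} \<noteq> {}"
proof -
  obtain S :: "'m set" where "card S = \<beta>"
    using sample_size obtain_subset_with_card_n[of \<beta> "UNIV :: 'm set"] by auto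
  then show ?thesis by blast
qed

lemma AE_choices:
  assumes "kc \<ge> 1"
  shows "AE \<omega> in M. card (\<tau> (Suc k) \<omega>) = \<beta> \<and> \<alpha>1 (Suc k) \<omega> \<in> {1..kc} \<and> \<alpha>2 (Suc k) \<omega> \<in> {1..kc}"
proof -
  let ?T = "{S :: 'm set. card S = \<beta>} \<times> {1..kc} \<times> {1..kc}"
  have "AE (S, a, b) in measure_pmf (pmf_of_set ?T). card S = \<beta> \<and> a \<in> {1..kc} \<and> b \<in> {1..kc}"
    using sampled_nonempty assms by (subst AE_measure_pmf_iff) (auto simp: set_pmf_of_set)
  then show ?thesis
    unfolding choices_uniform[of k, symmetric]
    by (rule AE_distrD[OF choices_measurable, THEN eventually_mono]) auto
qed

abbreviation sampled :: "nat \<Rightarrow> 'm \<Rightarrow> 'w set" where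
  "sampled k j \<equiv> {\<omega> \<in> space M. j \<in> \<tau> k \<omega>}"

text \<open>
  In terms of the whole triple of choices, the event has the form in which both the
  distribution of the choices and their independence from the past are known.
\<close>
lemma sampled_vimage:
  "sampled (Suc k) j =
    (\<lambda>\<omega>. (\<tau> (Suc k) \<omega>, \<alpha>1 (Suc k) \<omega>, \<alpha>2 (Suc k) \<omega>)) -` {(S, a, b). j \<in> S} \<inter> space M"
  by auto

lemma sampled_events: "sampled (Suc k) j \<in> events"
  unfolding sampled_vimage by (rule measurable_sets[OF choices_measurable]) simp

lemma prob_sampled:
  assumes "kc \<ge> 1"
  shows "prob (sampled (Suc k) j) = \<beta> / CARD('m)"
proof -
  let ?S = "{S :: 'm set. card S = \<beta>}" and ?K = "{1..kc} \<times> {1..kc}"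
  have "prob (sampled (Suc k) j) = measure (measure_pmf (pmf_of_set (?S \<times> ?K))) {(S, a, b). j \<in> S}"
    unfolding sampled_vimage choices_uniform[of k, symmetric]
    by (rule measure_distr[symmetric, OF choices_measurable]) simp
  also have "\<dots> = card ((?S \<times> ?K) \<inter> {(S, a, b). j \<in> S}) / card (?S \<times> ?K)"
    using sampled_nonempty assms by (intro measure_pmf_of_set) auto
  also have "(?S \<times> ?K) \<inter> {(S, a, b). j \<in> S} = {S. card S = \<beta> \<and> j \<in> S} \<times> ?K"
    by auto
  also have "card \<dots> / card (?S \<times> ?K) = card {S. card S = \<beta> \<and> j \<in> S} / card ?S"
    using assms by (simp add: card_cartesian_product)
  also have "\<dots> = \<beta> / CARD('m)"
  proof -
    have "card ?S > 0"
      using sampled_nonempty by (simp add: card_gt_0_iff)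
    moreover have "real \<beta> * card ?S = CARD('m) * card {S. card S = \<beta> \<and> j \<in> S}"
      using card_subsets_containing[of \<beta> j] by (metis of_nat_mult)
    ultimately show ?thesis
      by (subst frac_eq_eq) (simp_all only: of_nat_eq_0_iff mult.commute, simp_all)
  qed
  finally show ?thesis .
qed

section \<open>Measurability of the iterates\<close>

text \<open>
  Every round starts from one of countably many points and has countably many outcomes for the row
  and the two set indices, so the iterates have countable range. This makes them
  measurable with respect to the discrete sigma-algebra, and then so is every function of
  an iterate, in particular the singular values and the norm of \<open>f'\<close> there.
\<close>
lemma iterate_adapted: "countable (x k ` space M) \<and> x k \<in> F k \<rightarrow>\<^sub>M count_space UNIV"
proof (induction k)
  case 0
  have "x 0 ` space M \<subseteq> {x0}"
    using start by auto
  moreover have "x 0 \<in> F 0 \<rightarrow>\<^sub>M count_space UNIV \<longleftrightarrow> (\<lambda>_. x0) \<in> F 0 \<rightarrow>\<^sub>M count_space UNIV"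
    using start by (intro measurable_cong) (simp add: space_F)
  ultimately show ?case
    using countable_subset[of "x 0 ` space M" "{x0}"] by simp
next
  case (Suc k)
  let ?s = "apskm_step f J C \<delta>"
  have "x (Suc k) ` space M \<subseteq> (\<lambda>(y, j, a, b). ?s y j a b) ` (x k ` space M \<times> UNIV)"
  proof
    fix v assume "v \<in> x (Suc k) ` space M"
    then obtain \<omega> where "\<omega> \<in> space M" "v = x (Suc k) \<omega>" by blast
    then show "v \<in> (\<lambda>(y, j, a, b). ?s y j a b) ` (x k ` space M \<times> UNIV)"
      by (intro image_eqI[of _ _ "(x k \<omega>, i (Suc k) \<omega>, \<alpha>1 (Suc k) \<omega>, \<alpha>2 (Suc k) \<omega>)"])
         (auto simp: iterate)
  qed
  moreover have "countable (x k ` space M \<times> (UNIV :: ('m \<times> nat \<times> nat) set))"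
    using Suc by (intro countable_SIGMA) auto
  ultimately have count: "countable (x (Suc k) ` space M)"
    using countable_image countable_subset by metis
  have \<alpha>: "\<alpha>1 (Suc k) \<in> F (Suc k) \<rightarrow>\<^sub>M count_space UNIV" "\<alpha>2 (Suc k) \<in> F (Suc k) \<rightarrow>\<^sub>M count_space UNIV"
    using measurable_compose[OF choices_adapted[of k], of "\<lambda>(S, a, b). a" "count_space UNIV"]
      measurable_compose[OF choices_adapted[of k], of "\<lambda>(S, a, b). b" "count_space UNIV"]
    by auto
  have "x k \<in> F (Suc k) \<rightarrow>\<^sub>M count_space (x k ` space M)"
    unfolding measurable_count_space_eq_countable[OF conjunct1[OF Suc]]
  proof (intro conjI ballI)
    show "x k \<in> space (F (Suc k)) \<rightarrow> x k ` space M"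
      by (auto simp: space_F)
    fix v
    have "x k -` {v} \<inter> space (F k) \<in> sets (F k)"
      using Suc by (intro measurable_sets[of _ _ "count_space UNIV"]) auto
    then show "x k -` {v} \<inter> space (F (Suc k)) \<in> sets (F (Suc k))"
      using sets_F_mono[of k "Suc k"] by (auto simp: space_F)
  qed
  then have "(\<lambda>\<omega>. ?s (x k \<omega>) (i (Suc k) \<omega>) (\<alpha>1 (Suc k) \<omega>) (\<alpha>2 (Suc k) \<omega>))
      \<in> F (Suc k) \<rightarrow>\<^sub>M count_space UNIV"
  proof (rule measurable_compose_countable'[rotated])
    show "countable (x k ` space M)" using Suc by simp
    fix y
    show "(\<lambda>\<omega>. ?s y (i (Suc k) \<omega>) (\<alpha>1 (Suc k) \<omega>) (\<alpha>2 (Suc k) \<omega>)) \<in> F (Suc k) \<rightarrow>\<^sub>M count_space UNIV"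
      by (rule measurable_compose_countable[OF _ row_adapted],
          rule measurable_compose_countable[OF _ \<alpha>(1)],
          rule measurable_compose_countable[OF _ \<alpha>(2)]) simp
  qed
  moreover have "x (Suc k) \<in> F (Suc k) \<rightarrow>\<^sub>M count_space UNIV \<longleftrightarrow>
      (\<lambda>\<omega>. ?s (x k \<omega>) (i (Suc k) \<omega>) (\<alpha>1 (Suc k) \<omega>) (\<alpha>2 (Suc k) \<omega>)) \<in> F (Suc k) \<rightarrow>\<^sub>M count_space UNIV"
    using iterate by (intro measurable_cong) (simp add: space_F)
  ultimately show ?case
    using count by simp
qed

lemma borel_measurable_iterate:
  fixes h :: "real^'n \<Rightarrow> real"
  shows "(\<lambda>\<omega>. h (x k \<omega>)) \<in> borel_measurable (F k)" and "(\<lambda>\<omega>. h (x k \<omega>)) \<in> borel_measurable M"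
proof -
  show F: "(\<lambda>\<omega>. h (x k \<omega>)) \<in> borel_measurable (F k)"
    by (rule measurable_compose[OF conjunct2[OF iterate_adapted]]) simp
  then show "(\<lambda>\<omega>. h (x k \<omega>)) \<in> borel_measurable M"
    by (rule measurable_from_subalg[OF subalgebra_F])
qed

section \<open>Decrease in conditional expectation\<close>

lemma real_cond_exp_sampled:
  fixes h :: "real^'n \<Rightarrow> real"
  assumes "kc \<ge> 1" and int: "integrable M (\<lambda>\<omega>. h (x k \<omega>))"
  shows "AE \<omega> in M. real_cond_exp M (F k) (\<lambda>\<omega>. h (x k \<omega>) * indicator (sampled (Suc k) j) \<omega>) \<omega>
    = h (x k \<omega>) * (\<beta> / CARD('m))"
proof -
  interpret finite_measure_subalgebra M "F k"
    by unfold_locales (rule subalgebra_F)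
  have [measurable]: "sampled (Suc k) j \<in> events"
    by (rule sampled_events)
  have "AE \<omega> in M. real_cond_exp M (F k) (\<lambda>\<omega>. h (x k \<omega>) * indicator (sampled (Suc k) j) \<omega>) \<omega>
      = h (x k \<omega>) * real_cond_exp M (F k) (indicator (sampled (Suc k) j)) \<omega>"
    using int by (intro real_cond_exp_mult borel_measurable_iterate integrable_real_mult_indicator) auto
  moreover have "AE \<omega> in M. real_cond_exp M (F k) (indicator (sampled (Suc k) j)) \<omega> = prob (sampled (Suc k) j)"
    by (rule real_cond_exp_indep_event[OF subalgebra_F choices_indep[of k]])
       (auto simp only: sampled_vimage)
  ultimately show ?thesis
    by eventually_elim (simp add: prob_sampled[OF assms(1)])
qed

text \<open>
  This is where the greedy choice of the row within the sample enters: a maximum is at least the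
  average.
\<close>
lemma sampled_row_max:
  assumes \<omega>: "\<omega> \<in> space M" and card: "card (\<tau> (Suc k) \<omega>) = \<beta>"
  shows "(\<Sum>j\<in>UNIV. (f (x k \<omega>) $ j)\<^sup>2 * indicator (sampled (Suc k) j) \<omega>)
    \<le> \<beta> * (f (x k \<omega>) $ i (Suc k) \<omega>)\<^sup>2"
proof -
  have "(\<Sum>j\<in>UNIV. (f (x k \<omega>) $ j)\<^sup>2 * indicator (sampled (Suc k) j) \<omega>)
      = (\<Sum>j\<in>\<tau> (Suc k) \<omega>. (f (x k \<omega>) $ j)\<^sup>2)"
    using \<omega> by (simp add: indicator_def of_bool_def if_distrib sum.If_cases cong: if_cong)
  also have "\<dots> \<le> (\<Sum>j\<in>\<tau> (Suc k) \<omega>. (f (x k \<omega>) $ i (Suc k) \<omega>)\<^sup>2)"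
    using row_max[OF \<omega>, of k]
    by (intro sum_mono) (auto simp: is_arg_max_linorder abs_le_square_iff)
  finally show ?thesis
    by (simp add: card)
qed

lemma invariant_ball:
  assumes kc: "kc \<ge> 1" and x0: "norm (x0 - z) \<le> r"
    and step: "\<And>y j a1 a2. norm (y - z) \<le> r \<Longrightarrow> a1 \<in> {1..kc} \<Longrightarrow> a2 \<in> {1..kc} \<Longrightarrow>
      norm (apskm_step f J C \<delta> y j a1 a2 - z) \<le> r"
  shows "AE \<omega> in M. norm (x k \<omega> - z) \<le> r"
proof (induction k)
  case 0
  show ?case
    using x0 by (intro AE_I2) (simp add: start)
next
  case (Suc k)
  show ?case
    using Suc AE_choices[OF kc, of k] AE_space
    by eventually_elim (auto simp: iterate intro!: step)
qed

text \<open>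
  The function \<open>w\<close> is the guaranteed decrease per unit of squared residual. The residual of the
  chosen row is replaced by the average over the sample because that average is a sum of
  products of a function of the current iterate and a sampling event independent of the past,
  for which the conditional expectation is known. Each such product is integrable since a
  decrease never exceeds the squared distance from which it is subtracted.
\<close>
lemma expected_decrease:
  fixes w :: "real^'n \<Rightarrow> real"
  assumes kc: "kc \<ge> 1" and x0: "norm (x0 - z) \<le> r"
    and w: "\<And>y. norm (y - z) \<le> r \<Longrightarrow> 0 \<le> w y"
    and step: "\<And>y j a1 a2. norm (y - z) \<le> r \<Longrightarrow> a1 \<in> {1..kc} \<Longrightarrow> a2 \<in> {1..kc} \<Longrightarrow>
      (norm (apskm_step f J C \<delta> y j a1 a2 - z))\<^sup>2 \<le> (norm (y - z))\<^sup>2 - w y * (f y $ j)\<^sup>2"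
  shows "AE \<omega> in M. norm (x k \<omega> - z) \<le> r"
    and "integrable M (\<lambda>\<omega>. (norm (x k \<omega> - z))\<^sup>2)"
    and "AE \<omega> in M. real_cond_exp M (F k) (\<lambda>\<omega>. (norm (x (Suc k) \<omega> - z))\<^sup>2) \<omega>
      \<le> (norm (x k \<omega> - z))\<^sup>2 - w (x k \<omega>) * (norm (f (x k \<omega>)))\<^sup>2 / CARD('m)"
proof -
  interpret finite_measure_subalgebra M "F k"
    by unfold_locales (rule subalgebra_F)
  show ball: "AE \<omega> in M. norm (x k \<omega> - z) \<le> r" for k
  proof (rule invariant_ball[OF kc x0])
    fix y j a1 a2
    assume y: "norm (y - z) \<le> r" and a: "a1 \<in> {1..kc}" "a2 \<in> {1..kc}"
    have "(norm (apskm_step f J C \<delta> y j a1 a2 - z))\<^sup>2 \<le> (norm (y - z))\<^sup>2"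
      using step[OF y a, of j] w[OF y] by (smt (verit) mult_nonneg_nonneg zero_le_power2)
    then show "norm (apskm_step f J C \<delta> y j a1 a2 - z) \<le> r"
      using y by (meson norm_ge_zero order_trans power2_le_imp_le)
  qed
  show int: "integrable M (\<lambda>\<omega>. (norm (x k \<omega> - z))\<^sup>2)" for k
    using ball[of k]
    by (intro integrable_const_bound[of _ "r\<^sup>2"] borel_measurable_iterate)
       (auto elim!: eventually_mono intro: power_mono)
  define h where "h j y = w y * (f y $ j)\<^sup>2 / \<beta>" for j y
  have "\<beta> > 0"
    using sample_size by simp
  have h_int: "integrable M (\<lambda>\<omega>. h j (x k \<omega>))" for j
  proof (rule Bochner_Integration.integrable_bound)
    show "integrable M (\<lambda>\<omega>. (norm (x k \<omega> - z))\<^sup>2 / \<beta>)"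
      using int[of k] by simp
    show "(\<lambda>\<omega>. h j (x k \<omega>)) \<in> borel_measurable M"
      by (rule borel_measurable_iterate)
    show "AE \<omega> in M. norm (h j (x k \<omega>)) \<le> norm ((norm (x k \<omega> - z))\<^sup>2 / \<beta>)"
      using ball[of k]
    proof eventually_elim
      case (elim \<omega>)
      \<comment> \<open>the set indices 1 are arbitrary: only the nonnegativity of the new distance matters\<close>
      have "0 \<le> (norm (apskm_step f J C \<delta> (x k \<omega>) j 1 1 - z))\<^sup>2"
        by simp
      also have "\<dots> \<le> (norm (x k \<omega> - z))\<^sup>2 - w (x k \<omega>) * (f (x k \<omega>) $ j)\<^sup>2"
        by (rule step[OF elim]) (use kc in auto)
      finally show ?case
        using w[OF elim] by (simp add: h_def divide_right_mono)
    qed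
  qed
  have hs_int: "integrable M (\<lambda>\<omega>. h j (x k \<omega>) * indicator (sampled (Suc k) j) \<omega>)" for j
    using sampled_events h_int by (intro integrable_real_mult_indicator)
  have "AE \<omega> in M. (norm (x (Suc k) \<omega> - z))\<^sup>2
      \<le> (norm (x k \<omega> - z))\<^sup>2 - (\<Sum>j\<in>UNIV. h j (x k \<omega>) * indicator (sampled (Suc k) j) \<omega>)"
    using ball[of k] AE_choices[OF kc, of k] AE_space
  proof eventually_elim
    case (elim \<omega>)
    have "(\<Sum>j\<in>UNIV. h j (x k \<omega>) * indicator (sampled (Suc k) j) \<omega>)
        = w (x k \<omega>) / \<beta> * (\<Sum>j\<in>UNIV. (f (x k \<omega>) $ j)\<^sup>2 * indicator (sampled (Suc k) j) \<omega>)"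
      unfolding sum_distrib_left h_def by (intro sum.cong refl) simp
    also have "\<dots> \<le> w (x k \<omega>) / \<beta> * (\<beta> * (f (x k \<omega>) $ i (Suc k) \<omega>)\<^sup>2)"
      using elim w[OF elim(1)] by (intro mult_left_mono sampled_row_max) auto
    also have "\<dots> = w (x k \<omega>) * (f (x k \<omega>) $ i (Suc k) \<omega>)\<^sup>2"
      using \<open>\<beta> > 0\<close> by simp
    finally show ?case
      using step[OF elim(1), of "\<alpha>1 (Suc k) \<omega>" "\<alpha>2 (Suc k) \<omega>" "i (Suc k) \<omega>"] elim(2,3)
      by (simp add: iterate)
  qed
  then have "AE \<omega> in M. real_cond_exp M (F k) (\<lambda>\<omega>. (norm (x (Suc k) \<omega> - z))\<^sup>2) \<omega>
      \<le> real_cond_exp M (F k) (\<lambda>\<omega>. (norm (x k \<omega> - z))\<^sup>2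
           - (\<Sum>j\<in>UNIV. h j (x k \<omega>) * indicator (sampled (Suc k) j) \<omega>)) \<omega>"
    using int hs_int
    by (intro real_cond_exp_mono Bochner_Integration.integrable_diff
          Bochner_Integration.integrable_sum) auto
  moreover have "AE \<omega> in M. real_cond_exp M (F k) (\<lambda>\<omega>. (norm (x k \<omega> - z))\<^sup>2
           - (\<Sum>j\<in>UNIV. h j (x k \<omega>) * indicator (sampled (Suc k) j) \<omega>)) \<omega>
      = real_cond_exp M (F k) (\<lambda>\<omega>. (norm (x k \<omega> - z))\<^sup>2) \<omega>
        - real_cond_exp M (F k) (\<lambda>\<omega>. \<Sum>j\<in>UNIV. h j (x k \<omega>) * indicator (sampled (Suc k) j) \<omega>) \<omega>"
    using int hs_int by (intro real_cond_exp_diff Bochner_Integration.integrable_sum) auto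
  moreover have "AE \<omega> in M. real_cond_exp M (F k) (\<lambda>\<omega>. (norm (x k \<omega> - z))\<^sup>2) \<omega> = (norm (x k \<omega> - z))\<^sup>2"
    by (rule real_cond_exp_F_meas[OF int borel_measurable_iterate(1)])
  moreover have "AE \<omega> in M. real_cond_exp M (F k)
        (\<lambda>\<omega>. \<Sum>j\<in>UNIV. h j (x k \<omega>) * indicator (sampled (Suc k) j) \<omega>) \<omega>
      = (\<Sum>j\<in>UNIV. real_cond_exp M (F k) (\<lambda>\<omega>. h j (x k \<omega>) * indicator (sampled (Suc k) j) \<omega>) \<omega>)"
    by (rule real_cond_exp_sum[OF hs_int])
  moreover have "AE \<omega> in M. \<forall>j\<in>UNIV.
        real_cond_exp M (F k) (\<lambda>\<omega>. h j (x k \<omega>) * indicator (sampled (Suc k) j) \<omega>) \<omega>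
      = h j (x k \<omega>) * (\<beta> / CARD('m))"
    using real_cond_exp_sampled[OF kc h_int] by (intro AE_finite_allI) auto
  ultimately show "AE \<omega> in M. real_cond_exp M (F k) (\<lambda>\<omega>. (norm (x (Suc k) \<omega> - z))\<^sup>2) \<omega>
      \<le> (norm (x k \<omega> - z))\<^sup>2 - w (x k \<omega>) * (norm (f (x k \<omega>)))\<^sup>2 / CARD('m)"
  proof eventually_elim
    case (elim \<omega>)
    have "(norm (f (x k \<omega>)))\<^sup>2 = (\<Sum>j\<in>UNIV. (f (x k \<omega>) $ j)\<^sup>2)"
      by (simp add: norm_vec_def L2_set_def sum_nonneg)
    then have "(\<Sum>j\<in>UNIV. h j (x k \<omega>) * (\<beta> / CARD('m)))
        = w (x k \<omega>) * (norm (f (x k \<omega>)))\<^sup>2 / CARD('m)"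
      using \<open>\<beta> > 0\<close> by (simp add: h_def sum_distrib_left sum_divide_distrib)
    with elim show ?case
      by simp
  qed
qed

end

section \<open>Convergence\<close>

lemma contracting_sequence_tendsto_zero:
  fixes e :: "nat \<Rightarrow> real"
  assumes nonneg: "\<And>k. 0 \<le> e k" and contr: "\<And>k. e (Suc k) \<le> q * e k" and "q < 1"
  shows "e \<longlonglongrightarrow> 0"
proof (rule real_tendsto_sandwich)
  let ?p = "max 0 q"
  show "\<forall>\<^sub>F k in sequentially. 0 \<le> e k"
    by (simp add: nonneg)
  have "e k \<le> ?p ^ k * e 0" for k
  proof (induction k)
    case (Suc k)
    have "e (Suc k) \<le> ?p * e k"
      using contr[of k] mult_right_mono[of q ?p "e k"] nonneg[of k] by simp
    also have "\<dots> \<le> ?p * (?p ^ k * e 0)"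
      using Suc by (intro mult_left_mono) auto
    finally show ?case by (simp add: mult_ac)
  qed simp
  then show "\<forall>\<^sub>F k in sequentially. e k \<le> ?p ^ k * e 0"
    by simp
  show "(\<lambda>k. ?p ^ k * e 0) \<longlonglongrightarrow> 0"
    using \<open>q < 1\<close> by (intro tendsto_mult_left_zero LIMSEQ_realpow_zero) auto
qed simp

lemma (in sigma_finite_subalgebra) integral_le_of_real_cond_exp_le:
  assumes "AE \<omega> in M. real_cond_exp M F g \<omega> \<le> h \<omega>" and g: "integrable M g" and h: "integrable M h"
  shows "(\<integral>\<omega>. g \<omega> \<partial>M) \<le> (\<integral>\<omega>. h \<omega> \<partial>M)"
  using integral_mono_AE[OF real_cond_exp_int(1)[OF g] h assms(1)] real_cond_exp_int(2)[OF g] by simp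

text \<open>
  It remains to compare the decrease with the squared distance in two ways: through \<open>f'\<close> at the
  current iterate, which gives the stated factor, and through \<open>f'\<close> at the solution together with
  the bound \<open>B\<close> of \<open>f'\<close> on the ball, which gives a uniform factor \<open>q < 1\<close> and hence convergence.
\<close>
theorem theorem6:
  fixes D :: "(real^'n) set" and f :: "real^'n \<Rightarrow> real^'m" and J :: "real^'n \<Rightarrow> real^'n^'m"
    and C :: "nat \<Rightarrow> (real^'n) set" and kc \<beta> :: nat and \<rho> \<eta> \<delta> :: real and x0 :: "real^'n"
    and M :: "'w measure" and F :: "nat \<Rightarrow> 'w measure"
    and \<tau> :: "nat \<Rightarrow> 'w \<Rightarrow> 'm set" and \<alpha>1 \<alpha>2 :: "nat \<Rightarrow> 'w \<Rightarrow> nat"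
    and i :: "nat \<Rightarrow> 'w \<Rightarrow> 'm" and x :: "nat \<Rightarrow> 'w \<Rightarrow> real^'n"
  assumes jacobian: "\<And>y. y \<in> D \<Longrightarrow> (f has_derivative (\<lambda>h. J y *v h)) (at y within D)"
    and x0_dom: "x0 \<in> D" and \<rho>_pos: "\<rho> > 0"
    and kc_pos: "kc \<ge> 1"
    and C_sets: "\<And>j. j \<in> {1..kc} \<Longrightarrow> C j \<noteq> {} \<and> closed (C j) \<and> convex (C j)"
    and C_nonempty: "(\<Inter>j\<in>{1..kc}. C j) \<noteq> {}"
    and tcc: "local_tangential_cone f J D x0 \<rho> \<eta>"
    and row_bdd: "\<And>y. y \<in> D \<Longrightarrow> row_bounded_below (J y)"
    and full_rank: "\<And>y. y \<in> D \<Longrightarrow> rank (J y) = CARD('n)"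
    and solvable: "\<exists>y\<in>cball x0 (\<rho>/2). f y = 0 \<and> y \<in> (\<Inter>j\<in>{1..kc}. C j)"
    and run: "apskm M F f J C kc \<beta> \<delta> x0 \<tau> \<alpha>1 \<alpha>2 i x"
  shows "(\<forall>k. AE \<omega> in M. x k \<omega> \<in> D) \<and>
    (\<exists>xs\<in>cball x0 (\<rho>/2). f xs = 0 \<and> xs \<in> (\<Inter>j\<in>{1..kc}. C j) \<and>
      (\<forall>k. integrable M (\<lambda>\<omega>. (norm (x k \<omega> - xs))\<^sup>2)) \<and>
      (\<lambda>k. \<integral>\<omega>. (norm (x k \<omega> - xs))\<^sup>2 \<partial>M) \<longlonglongrightarrow> 0 \<and>
      (\<forall>k\<ge>1.
        (AE \<omega> in M.
          real_cond_exp M (F (k - 1)) (\<lambda>\<omega>. (norm (x k \<omega> - xs))\<^sup>2) \<omega>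
          \<le> (1 - (1 - 2 * \<eta>) * (sigma_min (J (x (k - 1) \<omega>)))\<^sup>2
                   / (real CARD('m) * (1 + \<eta>)\<^sup>2 * (frobenius_norm (J (x (k - 1) \<omega>)))\<^sup>2))
             * (norm (x (k - 1) \<omega> - xs))\<^sup>2) \<and>
        (\<integral>\<omega>. (norm (x k \<omega> - xs))\<^sup>2 \<partial>M)
          \<le> (\<integral>\<omega>. (1 - (1 - 2 * \<eta>) * (sigma_min (J (x (k - 1) \<omega>)))\<^sup>2
                   / (real CARD('m) * (1 + \<eta>)\<^sup>2 * (frobenius_norm (J (x (k - 1) \<omega>)))\<^sup>2))
             * (norm (x (k - 1) \<omega> - xs))\<^sup>2 \<partial>M)))"
proof -
  interpret apskm M F f J C kc \<beta> \<delta> x0 \<tau> \<alpha>1 \<alpha>2 i x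
    by (rule run)
  let ?m = "real CARD('m)"
  have \<rho>0: "\<rho> \<ge> 0"
    using \<rho>_pos by simp
  note cone = local_tangential_coneD[OF tcc \<rho>0]
  obtain z where z: "z \<in> cball x0 (\<rho>/2)" "f z = 0" "z \<in> (\<Inter>j\<in>{1..kc}. C j)"
    using solvable by blast
  have x0z: "norm (x0 - z) \<le> \<rho>/2"
    using z(1) by (simp add: dist_norm)
  have z_ball: "z \<in> cball x0 \<rho>"
    using z(1) \<rho>0 by simp
  have ball: "y \<in> cball x0 \<rho>" if "norm (y - z) \<le> \<rho>/2" for y
  proof -
    have "dist x0 y \<le> dist x0 z + dist y z"
      by (rule dist_triangle2)
    then show ?thesis
      using that z(1) by (simp add: dist_norm)
  qed
  have inD: "y \<in> D" if "y \<in> cball x0 \<rho>" for y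
    using that cone(1) by blast
  have row_pos: "0 < norm (row j (J y))" if "y \<in> cball x0 \<rho>" for y j
    using row_bdd[OF inD[OF that]] unfolding row_bounded_below_def by (meson less_le_trans)
  have frob_pos: "0 < frobenius_norm (J y)" if "y \<in> cball x0 \<rho>" for y
    using row_pos[OF that] norm_row_le_frobenius by (meson less_le_trans)
  define w where "w y = (1 - 2 * \<eta>) / (frobenius_norm (J y))\<^sup>2" for y
  have w_nonneg: "0 \<le> w y" for y
    using cone(2) by (simp add: w_def)
  have step: "(norm (apskm_step f J C \<delta> y j a1 a2 - z))\<^sup>2 \<le> (norm (y - z))\<^sup>2 - w y * (f y $ j)\<^sup>2"
    if y: "norm (y - z) \<le> \<rho>/2" and a: "a1 \<in> {1..kc}" "a2 \<in> {1..kc}" for y j a1 a2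
  proof -
    note yb = ball[OF y]
    have "(norm (apskm_step f J C \<delta> y j a1 a2 - z))\<^sup>2
        \<le> (norm (y - z))\<^sup>2 - (1 - 2 * \<eta>) * (f y $ j)\<^sup>2 / (norm (row j (J y)))\<^sup>2"
    proof (rule apskm_step_decrease)
      show "closed (C a) \<and> convex (C a) \<and> z \<in> C a" if "a \<in> {a1, a2}" for a
      proof -
        have "a \<in> {1..kc}"
          using that a by auto
        then show ?thesis
          using C_sets[of a] z(3) by blast
      qed
      show "row j (J y) \<noteq> 0"
        using row_pos[OF yb, of j] by auto
      show "\<bar>f y $ j - row j (J y) \<bullet> (y - z)\<bar> \<le> \<eta> * \<bar>f y $ j\<bar>"
        using cone(4)[OF yb z_ball, of j] z(2) by simp
    qed
    also have "\<dots> \<le> (norm (y - z))\<^sup>2 - (1 - 2 * \<eta>) * (f y $ j)\<^sup>2 / (frobenius_norm (J y))\<^sup>2"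
      using cone(2) row_pos[OF yb, of j] frob_pos[OF yb] norm_row_le_frobenius[of j "J y"]
      by (intro diff_left_mono divide_left_mono power_mono mult_pos_pos) auto
    finally show ?thesis
      by (simp add: w_def)
  qed
  have decrease: "AE \<omega> in M. norm (x k \<omega> - z) \<le> \<rho>/2"
    "integrable M (\<lambda>\<omega>. (norm (x k \<omega> - z))\<^sup>2)"
    "AE \<omega> in M. real_cond_exp M (F k) (\<lambda>\<omega>. (norm (x (Suc k) \<omega> - z))\<^sup>2) \<omega>
      \<le> (norm (x k \<omega> - z))\<^sup>2 - w (x k \<omega>) * (norm (f (x k \<omega>)))\<^sup>2 / ?m" for k
    by (rule expected_decrease[OF kc_pos x0z w_nonneg step]; assumption)+

  have residual: "(sigma_min (J y))\<^sup>2 * (norm (y - z))\<^sup>2 \<le> (1 + \<eta>)\<^sup>2 * (norm (f y))\<^sup>2"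
    and residual_z: "(sigma_min (J z))\<^sup>2 * (norm (y - z))\<^sup>2 \<le> (1 + \<eta>)\<^sup>2 * (norm (f y))\<^sup>2"
    if y: "y \<in> cball x0 \<rho>" for y
  proof -
    note \<sigma> = sigma_min_full_column_rank[OF full_rank[OF inD]]
    have "sigma_min (J y) * norm (y - z) \<le> (1 + \<eta>) * norm (f y)"
      using \<sigma>(2)[OF y, of "y - z"] tangential_cone_jacobian_le[OF tcc \<rho>0 y z_ball] z(2) by simp
    then have "(sigma_min (J y) * norm (y - z))\<^sup>2 \<le> ((1 + \<eta>) * norm (f y))\<^sup>2"
      using \<sigma>(1)[OF y] by (intro power_mono) auto
    then show "(sigma_min (J y))\<^sup>2 * (norm (y - z))\<^sup>2 \<le> (1 + \<eta>)\<^sup>2 * (norm (f y))\<^sup>2"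
      by (simp add: power_mult_distrib)
    have "sigma_min (J z) * norm (y - z) \<le> (1 + \<eta>) * norm (f y)"
      using \<sigma>(2)[OF z_ball, of "z - y"] tangential_cone_jacobian_le[OF tcc \<rho>0 z_ball y] z(2)
      by (simp add: norm_minus_commute)
    then have "(sigma_min (J z) * norm (y - z))\<^sup>2 \<le> ((1 + \<eta>) * norm (f y))\<^sup>2"
      using \<sigma>(1)[OF z_ball] by (intro power_mono) auto
    then show "(sigma_min (J z))\<^sup>2 * (norm (y - z))\<^sup>2 \<le> (1 + \<eta>)\<^sup>2 * (norm (f y))\<^sup>2"
      by (simp add: power_mult_distrib)
  qed
  \<comment> \<open>\<open>d\<close> is a squared distance, \<open>r\<close> a squared residual, and \<open>b\<close>, \<open>b'\<close> are the norm of \<open>f'\<close> and a bound for it\<close>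
  have compare: "d - v / b\<^sup>2 * r / ?m \<le> (1 - v * s / (?m * (1 + \<eta>)\<^sup>2 * b'\<^sup>2)) * d"
    if "s * d \<le> (1 + \<eta>)\<^sup>2 * r" "0 \<le> v" "0 < b" "b \<le> b'" "0 \<le> r" for d v b b' r s :: real
  proof -
    have "v * s / (?m * (1 + \<eta>)\<^sup>2 * b'\<^sup>2) * d = v / (?m * b'\<^sup>2) * (s * d / (1 + \<eta>)\<^sup>2)"
      by (simp add: mult_ac)
    also have "\<dots> \<le> v / (?m * b'\<^sup>2) * r"
      using that cone(3) by (intro mult_left_mono) (auto simp: pos_divide_le_eq mult.commute)
    also have "\<dots> \<le> v / (?m * b\<^sup>2) * r"
      using that by (intro mult_right_mono divide_left_mono mult_left_mono power_mono) auto
    also have "\<dots> = v / b\<^sup>2 * r / ?m"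
      by simp
    finally show ?thesis
      by (simp only: left_diff_distrib mult_1_left diff_left_mono)
  qed

  define fac where "fac y = 1 - (1 - 2 * \<eta>) * (sigma_min (J y))\<^sup>2
      / (?m * (1 + \<eta>)\<^sup>2 * (frobenius_norm (J y))\<^sup>2)" for y
  have fac_decrease: "(norm (y - z))\<^sup>2 - w y * (norm (f y))\<^sup>2 / ?m \<le> fac y * (norm (y - z))\<^sup>2"
    if "norm (y - z) \<le> \<rho>/2" for y
    unfolding w_def fac_def
    by (rule compare) (use residual[OF ball[OF that]] cone(2) frob_pos[OF ball[OF that]] in simp_all)
  have fac_bounds: "0 \<le> fac y \<and> fac y \<le> 1" if "y \<in> cball x0 \<rho>" for y
  proof -
    have \<sigma>: "0 < sigma_min (J y)" "sigma_min (J y) \<le> frobenius_norm (J y)"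
      using full_rank[OF inD[OF that]]
      by (rule sigma_min_full_column_rank(1), rule sigma_min_le_frobenius)
    have "1 * 1 \<le> ?m * (1 + \<eta>)\<^sup>2"
    proof (rule mult_mono)
      show "1 \<le> ?m"
        by (simp add: Suc_leI)
      show "1 \<le> (1 + \<eta>)\<^sup>2"
        using cone(3) by (simp add: one_le_power)
    qed simp_all
    moreover have "(1 - 2 * \<eta>) * (sigma_min (J y))\<^sup>2 \<le> 1 * (frobenius_norm (J y))\<^sup>2"
      using cone(2,3) \<sigma> by (intro mult_mono power_mono) simp_all
    ultimately have "(1 - 2 * \<eta>) * (sigma_min (J y))\<^sup>2
        \<le> (?m * (1 + \<eta>)\<^sup>2) * (frobenius_norm (J y))\<^sup>2"
      using mult_right_mono[of 1 "?m * (1 + \<eta>)\<^sup>2" "(frobenius_norm (J y))\<^sup>2"] by simp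
    then show ?thesis
      using frob_pos[OF that] cone(2,3) by (simp add: fac_def divide_le_eq)
  qed

  have "continuous_on D f"
    unfolding continuous_on_eq_continuous_within
    using has_derivative_continuous[OF jacobian] by blast
  then have "continuous_on (cball x0 \<rho>) f"
    using cone(1) by (rule continuous_on_subset)
  then obtain B where B: "\<And>y. y \<in> cball x0 \<rho> \<Longrightarrow> frobenius_norm (J y) \<le> B"
    by (rule tangential_cone_jacobian_bounded[OF tcc \<rho>_pos]) blast
  define q where "q = 1 - (1 - 2 * \<eta>) * (sigma_min (J z))\<^sup>2 / (?m * (1 + \<eta>)\<^sup>2 * B\<^sup>2)"
  have q_decrease: "(norm (y - z))\<^sup>2 - w y * (norm (f y))\<^sup>2 / ?m \<le> q * (norm (y - z))\<^sup>2"
    if "norm (y - z) \<le> \<rho>/2" for y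
    unfolding w_def q_def
    by (rule compare)
       (use residual_z[OF ball[OF that]] cone(2) frob_pos[OF ball[OF that]] B[OF ball[OF that]]
         in simp_all)
  have "q < 1"
  proof -
    have "0 < B"
      using frob_pos[OF z_ball] B[OF z_ball] by simp
    moreover have "0 < sigma_min (J z)"
      using sigma_min_full_column_rank(1)[OF full_rank[OF inD[OF z_ball]]] .
    ultimately show ?thesis
      using cone(2,3) by (simp add: q_def)
  qed

  define e where "e k = (\<integral>\<omega>. (norm (x k \<omega> - z))\<^sup>2 \<partial>M)" for k
  have cond_exp: "AE \<omega> in M. real_cond_exp M (F k) (\<lambda>\<omega>. (norm (x (Suc k) \<omega> - z))\<^sup>2) \<omega>
      \<le> g (x k \<omega>) * (norm (x k \<omega> - z))\<^sup>2"
    if "\<And>y. norm (y - z) \<le> \<rho>/2 \<Longrightarrow>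
      (norm (y - z))\<^sup>2 - w y * (norm (f y))\<^sup>2 / ?m \<le> g y * (norm (y - z))\<^sup>2" for g k
    using decrease(1)[of k] decrease(3)[of k] by eventually_elim (meson order_trans that)
  have expectation: "e (Suc k) \<le> (\<integral>\<omega>. g (x k \<omega>) * (norm (x k \<omega> - z))\<^sup>2 \<partial>M)"
    if "\<And>y. norm (y - z) \<le> \<rho>/2 \<Longrightarrow>
      (norm (y - z))\<^sup>2 - w y * (norm (f y))\<^sup>2 / ?m \<le> g y * (norm (y - z))\<^sup>2"
      and "integrable M (\<lambda>\<omega>. g (x k \<omega>) * (norm (x k \<omega> - z))\<^sup>2)" for g k
  proof -
    interpret finite_measure_subalgebra M "F k"
      by unfold_locales (rule subalgebra_F)
    show ?thesis
      unfolding e_def by (rule integral_le_of_real_cond_exp_le[OF cond_exp[OF that(1)] decrease(2) that(2)])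
  qed
  have fac_int: "integrable M (\<lambda>\<omega>. fac (x k \<omega>) * (norm (x k \<omega> - z))\<^sup>2)" for k
  proof (rule Bochner_Integration.integrable_bound[OF decrease(2)[of k]])
    show "(\<lambda>\<omega>. fac (x k \<omega>) * (norm (x k \<omega> - z))\<^sup>2) \<in> borel_measurable M"
      by (rule borel_measurable_iterate(2)[of "\<lambda>y. fac y * (norm (y - z))\<^sup>2"])
    show "AE \<omega> in M. norm (fac (x k \<omega>) * (norm (x k \<omega> - z))\<^sup>2) \<le> norm ((norm (x k \<omega> - z))\<^sup>2)"
      using decrease(1)[of k]
      by eventually_elim (use fac_bounds ball in \<open>auto simp: abs_mult intro!: mult_left_le_one_le\<close>)
  qed
  have "e \<longlonglongrightarrow> 0"
  proof (rule contracting_sequence_tendsto_zero)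
    show "0 \<le> e k" for k
      by (simp add: e_def)
    show "e (Suc k) \<le> q * e k" for k
      using expectation[of "\<lambda>_. q" k, OF q_decrease] decrease(2)[of k] by (simp add: e_def)
  qed (rule \<open>q < 1\<close>)
  moreover have "AE \<omega> in M. x k \<omega> \<in> D" for k
    using decrease(1)[of k] by eventually_elim (rule inD[OF ball])
  moreover have "(AE \<omega> in M. real_cond_exp M (F (k - 1)) (\<lambda>\<omega>. (norm (x k \<omega> - z))\<^sup>2) \<omega>
        \<le> fac (x (k - 1) \<omega>) * (norm (x (k - 1) \<omega> - z))\<^sup>2) \<and>
      e k \<le> (\<integral>\<omega>. fac (x (k - 1) \<omega>) * (norm (x (k - 1) \<omega> - z))\<^sup>2 \<partial>M)" if "k \<ge> 1" for k
    using cond_exp[of fac "k - 1", OF fac_decrease] expectation[of fac "k - 1", OF fac_decrease fac_int] that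
    by simp
  ultimately show ?thesis
    using z decrease(2) unfolding e_def fac_def by blast
qed

end
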